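(* Let $K\ge1$ be an integer and let $p$ be a prime with $p\mid K^2+4$. Then for every integer $j\ge1$ and every integer $N\ge1$, $p\mid \pi_K^N(p^j)$.
   Context: The $K$-Fibonacci sequence is $F_{K,0}=0$, $F_{K,1}=1$, $F_{K,n}=K F_{K,n-1}+F_{K,n-2}$; for an integer $m>1$, $\pi_K(m)$ is the length of its shortest period modulo $m$; iterates are $\pi_K^1=\pi_K$ and $\pi_K^{N+1}(m)=\pi_K(\pi_K^N(m))$. *)

theory Defs
  imports "HOL-Number_Theory.Number_Theory"
begin

fun kfib :: "nat \<Rightarrow> nat \<Rightarrow> nat" where
  "kfib K 0 = 0"
| "kfib K (Suc 0) = 1"
| "kfib K (Suc (Suc n)) = K * kfib K (Suc n) + kfib K n"

text \<open>
  Modulo any \<open>m \<ge> 1\<close> the sequence is purely periodic, since the recurrence can be run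
  backwards; hence a period is required to hold from index 0 on. The value at \<open>m = 0\<close>
  carries no meaning.
\<close>
definition kperiod :: "nat \<Rightarrow> nat \<Rightarrow> nat" where
  "kperiod K m = (LEAST d. d > 0 \<and> (\<forall>n. [kfib K (n + d) = kfib K n] (mod m)))"

end

theory Submission
  imports Defs
begin

text \<open>
  Since \<open>K\<^sup>2 + 4\<close> is the discriminant of the characteristic polynomial \<open>x\<^sup>2 - K x - 1\<close>, that
  polynomial has the double root \<open>K / 2\<close> modulo an odd prime \<open>p\<close> dividing \<open>K\<^sup>2 + 4\<close>, and
  \<open>F\<^sub>n = n (K / 2)\<^bsup>n - 1\<^esup>\<close> modulo \<open>p\<close>. Hence \<open>p\<close> divides every period modulo \<open>p\<close>, and so
  every period modulo a multiple of \<open>p\<close>: divisibility by \<open>p\<close> is passed from \<open>m\<close> to \<open>\<pi>\<^sub>K(m)\<close>.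
  For \<open>p = 2\<close> the number \<open>K\<close> is even and \<open>F\<^sub>n\<close> has the parity of \<open>n\<close>.
\<close>

lemma kfib_cong_pair_forward:
  assumes "[kfib K i = kfib K j] (mod m)" "[kfib K (Suc i) = kfib K (Suc j)] (mod m)"
  shows "[kfib K (i + n) = kfib K (j + n)] (mod m) \<and>
         [kfib K (Suc (i + n)) = kfib K (Suc (j + n))] (mod m)"
proof (induction n)
  case 0
  then show ?case using assms by simp
next
  case (Suc n)
  then show ?case by (auto intro!: cong_add cong_mult)
qed

text \<open>The earlier term enters the recurrence with coefficient 1, so it cancels without
  inverting \<open>K\<close>. This makes a repeated pair force periodicity from index 0.\<close>

lemma kfib_cong_pair_backward:
  assumes "[kfib K (i + d) = kfib K i] (mod m)" "[kfib K (Suc (i + d)) = kfib K (Suc i)] (mod m)"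
  shows "[kfib K d = kfib K 0] (mod m) \<and> [kfib K (Suc d) = kfib K (Suc 0)] (mod m)"
  using assms
proof (induction i)
  case 0
  then show ?case by simp
next
  case (Suc i)
  have "[K * kfib K (Suc (i + d)) + kfib K (i + d) = K * kfib K (Suc i) + kfib K i] (mod m)"
    using Suc.prems(2) by simp
  moreover have "[K * kfib K (Suc i) + kfib K i = K * kfib K (Suc (i + d)) + kfib K i] (mod m)"
    using Suc.prems(1) by (intro cong_add cong_mult) (auto simp: cong_sym)
  ultimately have "[kfib K (i + d) = kfib K i] (mod m)"
    using cong_trans cong_add_lcancel_nat by blast
  then show ?case using Suc by simp
qed

lemma kfib_period_exists:
  assumes "m > 0"
  shows "\<exists>d>0. \<forall>n. [kfib K (n + d) = kfib K n] (mod m)"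
proof -
  \<comment> \<open>Pigeonhole: only finitely many pairs of consecutive residues exist, and one pair
    determines the whole sequence.\<close>
  let ?f = "\<lambda>n. (kfib K n mod m, kfib K (Suc n) mod m)"
  have "range ?f \<subseteq> {..<m} \<times> {..<m}"
    using assms by auto
  then have "finite (range ?f)"
    by (rule finite_subset) simp
  then have "\<not> inj ?f"
    using finite_imageD infinite_UNIV_nat by blast
  then obtain i j where "i < j" and eq: "?f i = ?f j"
    by (metis (no_types, lifting) linorder_injI)
  then obtain d where d: "d > 0" "j = i + d"
    using less_imp_add_positive by blast
  have "[kfib K d = kfib K 0] (mod m) \<and> [kfib K (Suc d) = kfib K (Suc 0)] (mod m)"
    using eq d by (intro kfib_cong_pair_backward[of K i]) (auto simp: cong_def)
  then have "[kfib K (d + n) = kfib K (0 + n)] (mod m)" for n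
    using kfib_cong_pair_forward by blast
  then show ?thesis
    using d(1) by (auto simp: add.commute)
qed

lemma
  assumes "m > 0"
  shows kperiod_pos: "kperiod K m > 0"
    and kperiod_cong: "[kfib K (n + kperiod K m) = kfib K n] (mod m)"
proof -
  have "kperiod K m > 0 \<and> (\<forall>n. [kfib K (n + kperiod K m) = kfib K n] (mod m))"
    unfolding kperiod_def by (rule LeastI_ex) (rule kfib_period_exists[OF assms])
  then show "kperiod K m > 0" "[kfib K (n + kperiod K m) = kfib K n] (mod m)"
    by auto
qed

text \<open>The double-root formula with the powers of 2 cleared, so that it holds modulo the
  discriminant itself.\<close>

lemma kfib_discriminant_dvd:
  "(int K)\<^sup>2 + 4 dvd 2 ^ n * int (kfib K (Suc n)) - int (Suc n) * int K ^ n"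
proof (induction n rule: induct_nat_012)
  case (ge2 n)
  let ?D = "\<lambda>n. 2 ^ n * int (kfib K (Suc n)) - int (Suc n) * int K ^ n"
  \<comment> \<open>\<open>2 ^ n * kfib K (Suc n)\<close> satisfies
    \<open>x (n+2) = 2 * K * x (n+1) + 4 * x n\<close> exactly; \<open>Suc n * K ^ n\<close> does so
    up to a multiple of the discriminant.\<close>
  have "?D (Suc (Suc n)) =
      2 * int K * ?D (Suc n) + 4 * ?D n + int (Suc n) * int K ^ n * ((int K)\<^sup>2 + 4)"
    by (simp add: algebra_simps power2_eq_square)
  moreover have "(int K)\<^sup>2 + 4 dvd \<dots>"
    using ge2 by (intro dvd_add dvd_mult dvd_refl)
  ultimately show ?case
    by metis
qed (auto simp: algebra_simps)

lemma even_kfib_iff: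
  assumes "even K"
  shows "even (kfib K n) \<longleftrightarrow> even n"
  by (induction n rule: induct_nat_012) (use assms in auto)

lemma prime_dvd_kfib_imp_dvd_index:
  assumes "prime p" "p dvd K\<^sup>2 + 4" "p dvd kfib K n"
  shows "p dvd n"
proof (cases n)
  case (Suc k)
  show ?thesis
  \<comment> \<open>For \<open>p = 2\<close> the factor \<open>K ^ k\<close> cannot be cancelled, as
    \<open>K\<close> is even.\<close>
  proof (cases "p = 2")
    case True
    then have "even K" using assms(2) by simp
    then show ?thesis using even_kfib_iff assms(3) True by blast
  next
    case False
    have "int p dvd (int K)\<^sup>2 + 4"
      using assms(2) by (metis of_nat_add of_nat_dvd_iff of_nat_numeral of_nat_power)
    then have "int p dvd 2 ^ k * int (kfib K n) - int n * int K ^ k"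
      using kfib_discriminant_dvd Suc dvd_trans by blast
    moreover have "int p dvd 2 ^ k * int (kfib K n)"
      using assms(3) by simp
    ultimately have "int p dvd int (n * K ^ k)"
      by (metis dvd_diffD1 dvd_diff_commute of_nat_mult of_nat_power dvd_diff_right_iff dvd_minus_iff)
    then have "p dvd n * K ^ k"
      using of_nat_dvd_iff by blast
    moreover have "\<not> p dvd K"
    proof
      assume "p dvd K"
      then have "p dvd 2 ^ 2"
        using assms(2) by (simp add: dvd_add_right_iff power2_eq_square)
      then show False
        using False assms(1) by (metis prime_dvd_power primes_dvd_imp_eq two_is_prime_nat)
    qed
    ultimately show ?thesis
      using assms(1) prime_dvd_mult_iff prime_dvd_power by blast
  qed
qed simp

lemma prime_dvd_kperiod:
  assumes "prime p" "p dvd K\<^sup>2 + 4" "p dvd m" "m > 0"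
  shows "p dvd kperiod K m"
proof -
  \<comment> \<open>Periodicity is used at index 0, where the sequence vanishes.\<close>
  have "[kfib K (kperiod K m) = 0] (mod m)"
    using kperiod_cong[OF assms(4), of K 0] by simp
  then have "p dvd kfib K (kperiod K m)"
    using assms(3) by (meson cong_0_iff dvd_trans)
  then show ?thesis
    using assms prime_dvd_kfib_imp_dvd_index by blast
qed

theorem theorem4p3:
  fixes K p j N :: nat
  assumes "K \<ge> 1" and "prime p" and "p dvd K\<^sup>2 + 4" and "j \<ge> 1" and "N \<ge> 1"
  shows "p dvd (kperiod K ^^ N) (p ^ j)"
proof -
  \<comment> \<open>Positivity is carried along so that each iterate is a legitimate modulus for the
    next.\<close>
  have "p dvd (kperiod K ^^ N) (p ^ j) \<and> (kperiod K ^^ N) (p ^ j) > 0"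
  proof (induction N)
    case 0
    then show ?case
      using assms prime_gt_0_nat by (simp add: dvd_power)
  next
    case (Suc N)
    then show ?case
      using assms prime_dvd_kperiod kperiod_pos by simp
  qed
  then show ?thesis ..
qed

end
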